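(* There exist $(\alpha,\beta)$-expanders $G$ with maximum degree $\Delta$ whose wireless expansion satisfies $$\beta_w(G)=O\!\left(\frac{\beta}{\log\bigl(2\cdot\min\{\Delta/\beta,\ \Delta\cdot\beta\}\bigr)}\right).$$
   Context: All graphs are finite and undirected; $G=(V,E)$ has $n=|V|$ vertices and logarithms are base 2. For $S\subseteq V$, $\Gamma(S)$ is the set of all neighbors of vertices of $S$ and $\Gamma^-(S)=\Gamma(S)\setminus S$. $G$ is an $(\alpha,\beta)$-expander if $|\Gamma^-(S)|\geq\beta|S|$ for every $S\subseteq V$ with $|S|\leq\alpha n$. For $S'\subseteq S\subseteq V$, $\Gamma^1_S(S')$ denotes the set of vertices of $V\setminus S$ that have exactly one neighbor in $S'$. The wireless expansion (with respect to $\alpha$) is $\beta_w(G)=\min_{S\subseteq V,\,|S|\leq\alpha n}\ \max_{S'\subseteq S}|\Gamma^1_S(S')|/|S|$. *)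

theory Defs
  imports Complex_Main "Graph_Theory.Graph_Theory"
begin

text \<open>
  Finite simple undirected graphs are the \<^locale>\<open>pair_graph\<close>s of the AFP entry Graph_Theory: every edge
  is represented by its two opposite arcs, so neighbours and degrees are out-neighbours and
  out-degrees.
\<close>

definition nbrs :: "'a pair_pre_digraph \<Rightarrow> 'a set \<Rightarrow> 'a set" where
  "nbrs G S = {v. \<exists>u\<in>S. (u, v) \<in> parcs G}"

definition outer_nbrs :: "'a pair_pre_digraph \<Rightarrow> 'a set \<Rightarrow> 'a set" where
  "outer_nbrs G S = nbrs G S - S"

definition max_degree :: "'a pair_pre_digraph \<Rightarrow> nat" where
  "max_degree G = Max (out_degree (with_proj G) ` pverts G)"

definition expander :: "real \<Rightarrow> real \<Rightarrow> 'a pair_pre_digraph \<Rightarrow> bool" where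
  "expander \<alpha> \<beta> G \<longleftrightarrow>
     (\<forall>S\<subseteq>pverts G. real (card S) \<le> \<alpha> * real (card (pverts G)) \<longrightarrow>
        real (card (outer_nbrs G S)) \<ge> \<beta> * real (card S))"

definition unique_nbrs :: "'a pair_pre_digraph \<Rightarrow> 'a set \<Rightarrow> 'a set \<Rightarrow> 'a set" where
  "unique_nbrs G S S' = {v \<in> pverts G - S. card {u \<in> S'. (u, v) \<in> parcs G} = 1}"

text \<open>
  The minimum ranges over nonempty \<open>S\<close> only, since the quotient is \<open>0 / 0\<close> for \<open>S = {}\<close>.  It is a
  minimum over a nonempty family iff \<open>\<alpha> * card (pverts G) \<ge> 1\<close> (for nonempty \<open>G\<close> and \<open>\<alpha> \<ge> 0\<close>);
  otherwise the value is unspecified.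
\<close>

definition wireless_expansion :: "real \<Rightarrow> 'a pair_pre_digraph \<Rightarrow> real" where
  "wireless_expansion \<alpha> G =
     Min ((\<lambda>S. Max ((\<lambda>S'. real (card (unique_nbrs G S S')) / real (card S)) ` Pow S)) `
       {S. S \<subseteq> pverts G \<and> S \<noteq> {} \<and> real (card S) \<le> \<alpha> * real (card (pverts G))})"

end

(*
  Core: a complete binary tree of height h, with a vertices of an independent set S at each leaf and
  b * 2^i vertices at each node of height i; a vertex of S is joined to the vertices at all ancestors
  of its leaf.  On every level a set X of S-vertices reaches at least (b/a) * |X| vertices, so X
  expands by b * (h + 1) / a.  For X in S, however, the nodes lying above exactly one vertex of X
  form disjoint vertical paths with geometrically growing weights, so only 2 * b * 2^h = (2b/a) * |S|
  vertices have a unique neighbour in X: a factor of order h is lost.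

  The core sits inside K_(Delta + 1): all vertices outside S are joined to each other.  A set that
  meets the clique then has all remaining clique vertices as neighbours, which is enough expansion
  as long as |S| is at most delta * (Delta + 1), and a vertex at the root has degree exactly Delta.
  Small values of alpha are handled by disjoint copies.  With h of order log (min (Delta / beta)
  (Delta * beta)) this gives the bound; when the minimum is bounded, the core with h = 0 or the
  complete graph suffices.
*)
theory Submission
  imports Defs
begin

section \<open>Counting by fibres of integer division\<close>

lemma div_fibre_eq: "0 < m \<Longrightarrow> {x. x div m = q} = {q * m..<Suc q * m}" for m q :: nat
proof (intro set_eqI iffI)
  fix x assume "0 < m" "x \<in> {x. x div m = q}"
  then show "x \<in> {q * m..<Suc q * m}"
    using dividend_less_div_times[of m x] by auto
next
  fix x assume "0 < m" "x \<in> {q * m..<Suc q * m}"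
  then show "x \<in> {x. x div m = q}" by (auto intro!: div_nat_eqI simp: mult.commute)
qed

lemma card_div_fibre: "0 < m \<Longrightarrow> card {x. x div m = q} = m" for m q :: nat
  by (simp add: div_fibre_eq)

lemma finite_div_fibre: "0 < m \<Longrightarrow> finite {x. x div m = q}" for m q :: nat
  by (simp add: div_fibre_eq)

lemma card_div_vimage:
  fixes m :: nat
  assumes "0 < m" "finite Q"
  shows "card {x. x div m \<in> Q} = m * card Q"
proof -
  have "card {x. x div m \<in> Q} = card (\<Union>q\<in>Q. {x. x div m = q})"
    by (rule arg_cong[where f = card]) auto
  also have "\<dots> = (\<Sum>q\<in>Q. card {x. x div m = q})"
    using assms by (intro card_UN_disjoint) (auto simp: finite_div_fibre)
  also have "\<dots> = m * card Q"
    using assms by (simp add: card_div_fibre)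
  finally show ?thesis .
qed

lemma finite_div_vimage: "0 < m \<Longrightarrow> finite Q \<Longrightarrow> finite {x. x div m \<in> Q}" for m :: nat
proof -
  assume "0 < m" "finite Q"
  moreover have "{x. x div m \<in> Q} = (\<Union>q\<in>Q. {x. x div m = q})" by auto
  ultimately show ?thesis by (simp add: finite_div_fibre)
qed

text \<open>Cuts a set into consecutive blocks of length \<open>n\<close>. The blocks will be the
  copies of a graph and, in \<open>card_levels\<close>, the levels of the core.\<close>

lemma card_tiles:
  fixes X :: "nat set"
  assumes "X \<subseteq> {..<t * n}"
  shows "card X = (\<Sum>c<t. card {u. u < n \<and> c * n + u \<in> X})"
proof -
  have X: "X = (\<Union>c<t. (\<lambda>u. c * n + u) ` {u. u < n \<and> c * n + u \<in> X})" (is "_ = ?R")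
  proof (intro set_eqI iffI)
    fix x assume x: "x \<in> X"
    with assms have *: "x < t * n" by auto
    then have "x div n < t" by (simp add: less_mult_imp_div_less)
    moreover have "x mod n < n" using * by (cases "n = 0") auto
    ultimately show "x \<in> ?R" using x
      by (auto intro!: bexI[of _ "x div n"] image_eqI[of _ _ "x mod n"])
  qed auto
  have "disjoint_family_on (\<lambda>c. (\<lambda>u. c * n + u) ` {u. u < n \<and> c * n + u \<in> X}) {..<t}"
    unfolding disjoint_family_on_def
  proof (intro ballI impI equals0I)
    fix c d x
    assume "c \<noteq> d" and "x \<in> (\<lambda>u. c * n + u) ` {u. u < n \<and> c * n + u \<in> X} \<inter>
      (\<lambda>u. d * n + u) ` {u. u < n \<and> d * n + u \<in> X}"
    then obtain u v where uv: "u < n" "v < n" "x = c * n + u" "x = d * n + v" by blast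
    have "x div n = c" unfolding uv(3) using uv(1) by simp
    moreover have "x div n = d" unfolding uv(4) using uv(2) by simp
    ultimately show False using \<open>c \<noteq> d\<close> by simp
  qed
  then have "card ?R = (\<Sum>c<t. card ((\<lambda>u. c * n + u) ` {u. u < n \<and> c * n + u \<in> X}))"
    by (intro card_UN_disjoint') auto
  also have "\<dots> = (\<Sum>c<t. card {u. u < n \<and> c * n + u \<in> X})"
    by (intro sum.cong refl card_image inj_onI) auto
  finally show ?thesis using X by simp
qed

section \<open>Nodes of a binary tree above exactly one point\<close>

lemma singleton_fibres_subset: "{q. card {x\<in>L. f x = q} = 1} \<subseteq> f ` L"
proof
  fix q assume "q \<in> {q. card {x\<in>L. f x = q} = 1}"
  then have "{x\<in>L. f x = q} \<noteq> {}" by force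
  then show "q \<in> f ` L" by blast
qed

text \<open>Here \<open>g x\<close> is the leaf of \<open>x\<close> and \<open>g x div 2 ^ i\<close>
  its ancestor of height \<open>i\<close>; call a node occupied if it lies above some point of
  \<open>L\<close>. An occupied node has at most two occupied children, and only one if it lies
  above a single point, so each such node leaves a slack of one.\<close>

lemma occupied_level_step:
  fixes g :: "'a \<Rightarrow> nat"
  assumes "finite L"
  shows "card ((\<lambda>x. g x div 2 ^ i) ` L) + card {q. card {x\<in>L. g x div 2 ^ Suc i = q} = 1}
    \<le> 2 * card ((\<lambda>x. g x div 2 ^ Suc i) ` L)"
proof -
  define A where "A = (\<lambda>x. g x div 2 ^ i) ` L"
  define B where "B = (\<lambda>x. g x div 2 ^ Suc i) ` L"
  define U where "U = {q. card {x\<in>L. g x div 2 ^ Suc i = q} = 1}"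
  have half: "g x div 2 ^ Suc i = g x div 2 ^ i div 2" for x
    by (simp only: power_Suc2 div_mult2_eq)
  have fin: "finite A" "finite B" using assms by (auto simp: A_def B_def)
  have U: "U \<subseteq> B"
    unfolding U_def B_def by (rule singleton_fibres_subset)
  have "A = (\<Union>q\<in>B. {p\<in>A. p div 2 = q})"
    by (auto simp: A_def B_def half simp del: power_Suc)
  then have "card A = card (\<Union>q\<in>B. {p\<in>A. p div 2 = q})" by simp
  also have "\<dots> = (\<Sum>q\<in>B. card {p\<in>A. p div 2 = q})"
    using fin by (intro card_UN_disjoint) auto
  finally have "card A = (\<Sum>q\<in>B. card {p\<in>A. p div 2 = q})" .
  moreover have "card {p\<in>A. p div 2 = q} + (if q \<in> U then 1 else 0) \<le> 2" if "q \<in> B" for q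
  proof (cases "q \<in> U")
    case True
    have "{p\<in>A. p div 2 = q} = (\<lambda>x. g x div 2 ^ i) ` {x\<in>L. g x div 2 ^ Suc i = q}"
      by (auto simp: A_def half simp del: power_Suc)
    then have "card {p\<in>A. p div 2 = q} \<le> card {x\<in>L. g x div 2 ^ Suc i = q}"
      using assms by (simp add: card_image_le)
    with True show ?thesis by (simp add: U_def)
  next
    case False
    have "card {p\<in>A. p div 2 = q} \<le> card {p. p div 2 = q}"
      by (intro card_mono finite_div_fibre) auto
    with False show ?thesis by (simp add: card_div_fibre)
  qed
  then have "(\<Sum>q\<in>B. card {p\<in>A. p div 2 = q} + (if q \<in> U then 1 else 0)) \<le> (\<Sum>q\<in>B. 2)"
    by (rule sum_mono)
  moreover have "(\<Sum>q\<in>B. if q \<in> U then 1 else 0) = card U"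
    using U fin by (simp add: sum.If_cases inf.absorb2)
  ultimately show ?thesis
    by (simp add: sum.distrib A_def B_def U_def)
qed

text \<open>Scaled by \<open>2 ^ Suc h\<close>, the inequality of \<open>occupied_level_step\<close>
  telescopes. The right side keeps the number of occupied nodes as a potential so that the induction
  goes through; at the height of the root this number is at most one.\<close>

lemma weighted_unique_nodes_le:
  fixes g :: "'a \<Rightarrow> nat"
  assumes "finite L"
  shows "(\<Sum>i\<le>h. 2 ^ i * card {q. card {x\<in>L. g x div 2 ^ i = q} = 1})
    \<le> 2 ^ Suc h * card ((\<lambda>x. g x div 2 ^ h) ` L)"
proof (induction h)
  case 0
  have "card {q. card {x\<in>L. g x = q} = 1} \<le> card (g ` L)"
    using assms by (intro card_mono singleton_fibres_subset) auto
  then show ?case by simp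
next
  case (Suc h)
  have "2 ^ Suc h * (card ((\<lambda>x. g x div 2 ^ h) ` L)
      + card {q. card {x\<in>L. g x div 2 ^ Suc h = q} = 1})
    \<le> 2 ^ Suc h * (2 * card ((\<lambda>x. g x div 2 ^ Suc h) ` L))"
    by (intro mult_left_mono occupied_level_step assms) auto
  with Suc show ?case by (simp add: algebra_simps)
qed

section \<open>Disjoint copies of a graph: vertex \<open>u\<close> of copy \<open>c\<close> is
  \<open>c * n + u\<close>\<close>

definition copies :: "nat \<Rightarrow> nat \<Rightarrow> (nat \<Rightarrow> nat \<Rightarrow> bool) \<Rightarrow> nat pair_pre_digraph" where
  "copies t n E = \<lparr>pverts = {..<t * n},
    parcs = {(u, v). u < t * n \<and> v < t * n \<and> u div n = v div n \<and> E (u mod n) (v mod n)}\<rparr>"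

lemma pverts_copies [simp]: "pverts (copies t n E) = {..<t * n}"
  by (simp add: copies_def)

lemma parcs_copies: "(u, v) \<in> parcs (copies t n E) \<longleftrightarrow>
    u < t * n \<and> v < t * n \<and> u div n = v div n \<and> E (u mod n) (v mod n)"
  by (simp add: copies_def)

lemma block_index_less: "c * n + u < t * n" if "c < t" "u < n" for c n u t :: nat
proof -
  have "c * n + u < Suc c * n" using that by simp
  also have "\<dots> \<le> t * n" using that by (intro mult_right_mono) auto
  finally show ?thesis .
qed

lemma pair_graph_copies:
  assumes "symp E" "irreflp E"
  shows "pair_graph (copies t n E)"
proof unfold_locales
  have "parcs (copies t n E) \<subseteq> {..<t * n} \<times> {..<t * n}"
    by (auto simp: parcs_copies)
  then show "finite (parcs (copies t n E))"
    by (rule finite_subset) simp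
  show "symmetric (copies t n E)"
    using assms(1) by (auto simp: symmetric_def parcs_copies intro!: symI dest: sympD)
  show "fst e \<noteq> snd e" if "e \<in> parcs (copies t n E)" for e
    using that assms(2) by (cases e) (auto simp: parcs_copies dest: irreflpD)
qed (auto simp: copies_def)

lemma out_degree_copies:
  assumes "v < t * n"
  shows "out_degree (with_proj (copies t n E)) v = card {u. u < n \<and> E (v mod n) u}"
proof -
  have v: "v div n < t" "v mod n < n" using assms
    by (simp add: less_mult_imp_div_less, cases "n = 0") auto
  have "out_arcs (with_proj (copies t n E)) v
    = (\<lambda>u. (v, v div n * n + u)) ` {u. u < n \<and> E (v mod n) u}"
  proof (intro set_eqI iffI)
    fix e assume "e \<in> out_arcs (with_proj (copies t n E)) v"
    then obtain w where w: "e = (v, w)" "w < t * n" "v div n = w div n" "E (v mod n) (w mod n)"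
      by (cases e) (auto simp: out_arcs_def parcs_copies)
    moreover have "w mod n < n" using v by (cases n) auto
    ultimately show "e \<in> (\<lambda>u. (v, v div n * n + u)) ` {u. u < n \<and> E (v mod n) u}"
      by (auto intro!: image_eqI[of _ _ "w mod n"])
  next
    fix e assume "e \<in> (\<lambda>u. (v, v div n * n + u)) ` {u. u < n \<and> E (v mod n) u}"
    then show "e \<in> out_arcs (with_proj (copies t n E)) v"
      using v assms by (auto simp: out_arcs_def parcs_copies block_index_less)
  qed
  then show ?thesis
    by (simp add: out_degree_def card_image inj_on_def)
qed

lemma max_degree_copies:
  assumes "0 < t" "irreflp E" "r < n" and r: "\<And>u. u < n \<Longrightarrow> u \<noteq> r \<Longrightarrow> E r u"
  shows "max_degree (copies t n E) = n - 1"
  unfolding max_degree_def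
proof (rule Max_eqI)
  fix d assume "d \<in> out_degree (with_proj (copies t n E)) ` pverts (copies t n E)"
  then obtain v where v: "v < t * n" and d: "d = card {u. u < n \<and> E (v mod n) u}"
    by (auto simp: out_degree_copies)
  have "{u. u < n \<and> E (v mod n) u} \<subseteq> {..<n} - {v mod n}"
    using assms(2) by (auto dest: irreflpD)
  then have "d \<le> card ({..<n} - {v mod n})"
    unfolding d by (intro card_mono) auto
  also have "\<dots> = n - 1" using assms(3) by simp
  finally show "d \<le> n - 1" .
next
  have "{u. u < n \<and> E r u} = {..<n} - {r}"
    using assms(2) r by (auto dest: irreflpD)
  then have "card {u. u < n \<and> E r u} = n - 1" using assms(3) by simp
  moreover have "r < t * n" using block_index_less[of 0 t r n] assms by simp
  ultimately show "n - 1 \<in> out_degree (with_proj (copies t n E)) ` pverts (copies t n E)"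
    using assms(3) by (intro image_eqI[of _ _ r]) (auto simp: out_degree_copies)
qed simp

text \<open>No arc joins two copies, so the slices \<open>Y c\<close> of \<open>X\<close> expand
  independently and their outer neighbours add up. The size bound in \<open>base\<close> refers to
  all \<open>t * n\<close> vertices because an admissible set may lie inside a single copy.\<close>

lemma expander_copies:
  assumes base: "\<And>X. X \<subseteq> {..<n} \<Longrightarrow> real (card X) \<le> \<alpha> * real (t * n) \<Longrightarrow>
      \<beta> * real (card X) \<le> real (card {v. v < n \<and> v \<notin> X \<and> (\<exists>u\<in>X. E u v)})"
  shows "expander \<alpha> \<beta> (copies t n E)"
  unfolding expander_def
proof (intro allI impI)
  let ?G = "copies t n E"
  fix X assume "X \<subseteq> pverts ?G" and small: "real (card X) \<le> \<alpha> * real (card (pverts ?G))"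
  then have X: "X \<subseteq> {..<t * n}" by simp
  define Y where "Y c = {u. u < n \<and> c * n + u \<in> X}" for c
  have card_X: "card X = (\<Sum>c<t. card (Y c))"
    unfolding Y_def by (rule card_tiles[OF X])
  have "outer_nbrs ?G X \<subseteq> {..<t * n}"
    by (auto simp: outer_nbrs_def nbrs_def parcs_copies)
  then have card_out: "card (outer_nbrs ?G X)
      = (\<Sum>c<t. card {u. u < n \<and> c * n + u \<in> outer_nbrs ?G X})"
    by (rule card_tiles)
  have "\<beta> * real (card X) = (\<Sum>c<t. \<beta> * real (card (Y c)))"
    by (simp add: card_X sum_distrib_left)
  also have "\<dots> \<le> (\<Sum>c<t. real (card {u. u < n \<and> c * n + u \<in> outer_nbrs ?G X}))"
  proof (rule sum_mono)
    fix c assume "c \<in> {..<t}"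
    then have c: "c < t" by simp
    have "card (Y c) \<le> card X"
      unfolding card_X using c by (intro member_le_sum) auto
    with small have "real (card (Y c)) \<le> \<alpha> * real (t * n)" by simp
    moreover have "Y c \<subseteq> {..<n}" by (auto simp: Y_def)
    ultimately have "\<beta> * real (card (Y c))
        \<le> real (card {v. v < n \<and> v \<notin> Y c \<and> (\<exists>u\<in>Y c. E u v)})"
      by (intro base)
    also have "\<dots> \<le> real (card {u. u < n \<and> c * n + u \<in> outer_nbrs ?G X})"
    proof (intro of_nat_mono card_mono subsetI)
      fix v assume "v \<in> {v. v < n \<and> v \<notin> Y c \<and> (\<exists>u\<in>Y c. E u v)}"
      then obtain u where "v < n" "c * n + v \<notin> X" "u < n" "c * n + u \<in> X" "E u v"
        by (auto simp: Y_def)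
      then show "v \<in> {u. u < n \<and> c * n + u \<in> outer_nbrs ?G X}"
        using c by (auto simp: outer_nbrs_def nbrs_def parcs_copies block_index_less
            intro!: bexI[of _ "c * n + u"])
    qed auto
    finally show "\<beta> * real (card (Y c))
        \<le> real (card {u. u < n \<and> c * n + u \<in> outer_nbrs ?G X})" .
  qed
  also have "\<dots> = real (card (outer_nbrs ?G X))"
    by (simp add: card_out)
  finally show "\<beta> * real (card X) \<le> real (card (outer_nbrs ?G X))" .
qed

text \<open>One admissible set bounds the minimum from above. Its existence also ensures that the
  minimum is over a nonempty family.\<close>

lemma wireless_expansion_le:
  assumes fin: "finite (pverts G)"
    and S: "S \<subseteq> pverts G" "S \<noteq> {}" "real (card S) \<le> \<alpha> * real (card (pverts G))"
    and le: "\<And>S'. S' \<subseteq> S \<Longrightarrow> real (card (unique_nbrs G S S')) \<le> c * real (card S)"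
  shows "wireless_expansion \<alpha> G \<le> c"
proof -
  have finS: "finite S" using S fin by (auto intro: finite_subset)
  then have "0 < real (card S)" using S by (simp add: card_gt_0_iff)
  have "wireless_expansion \<alpha> G
      \<le> Max ((\<lambda>S'. real (card (unique_nbrs G S S')) / real (card S)) ` Pow S)"
    unfolding wireless_expansion_def
  proof (rule Min_le)
    have "finite {S. S \<subseteq> pverts G \<and> S \<noteq> {} \<and> real (card S) \<le> \<alpha> * real (card (pverts G))}"
      by (rule finite_subset[of _ "Pow (pverts G)"]) (use fin in auto)
    then show "finite ((\<lambda>S. Max ((\<lambda>S'. real (card (unique_nbrs G S S')) / real (card S)) ` Pow S)) `
        {S. S \<subseteq> pverts G \<and> S \<noteq> {} \<and> real (card S) \<le> \<alpha> * real (card (pverts G))})"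
      by (rule finite_imageI)
  qed (use S in auto)
  also have "\<dots> \<le> c"
    using finS \<open>0 < real (card S)\<close> le by (subst Max_le_iff) (auto simp: divide_le_eq)
  finally show ?thesis .
qed

section \<open>The core: a binary tree attached to a clique\<close>

text \<open>
  In the core, \<open>S\<close> consists of the \<open>x < a * 2 ^ h\<close>, with \<open>x\<close> at leaf \<open>x div a\<close>.  The vertices of
  height \<open>i\<close> form the \<open>i\<close>-th block of length \<open>b * 2 ^ h\<close> after \<open>S\<close>; the nodes of height \<open>i\<close> are
  numbered from the left, so that the ancestor of leaf \<open>l\<close> is \<open>l div 2 ^ i\<close>.  For \<open>a = 0\<close> the set \<open>S\<close> is
  empty and \<open>core_adj\<close> is the complete graph.
\<close>

definition tree_edge :: "nat \<Rightarrow> nat \<Rightarrow> nat \<Rightarrow> nat \<Rightarrow> nat \<Rightarrow> bool" where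
  "tree_edge a b h x y \<longleftrightarrow> x < a * 2 ^ h \<and>
    (\<exists>i\<le>h. \<exists>j<b * 2 ^ h. y = a * 2 ^ h + i * (b * 2 ^ h) + j \<and> x div a div 2 ^ i = j div b div 2 ^ i)"

definition core_adj :: "nat \<Rightarrow> nat \<Rightarrow> nat \<Rightarrow> nat \<Rightarrow> nat \<Rightarrow> bool" where
  "core_adj a b h x y \<longleftrightarrow> x \<noteq> y \<and>
    (a * 2 ^ h \<le> x \<and> a * 2 ^ h \<le> y \<or> tree_edge a b h x y \<or> tree_edge a b h y x)"

lemma block_index_inject:
  fixes i i' j j' w :: nat
  assumes "j < w" "j' < w" "i * w + j = i' * w + j'"
  shows "i = i' \<and> j = j'"
proof -
  have "i = (i * w + j) div w" using assms(1) by simp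
  also have "\<dots> = i'" unfolding assms(3) using assms(2) by simp
  finally show ?thesis using assms(3) by simp
qed

lemma tree_edge_index:
  assumes "i \<le> h" "j < b * 2 ^ h"
  shows "tree_edge a b h x (a * 2 ^ h + i * (b * 2 ^ h) + j)
    \<longleftrightarrow> x < a * 2 ^ h \<and> x div a div 2 ^ i = j div b div 2 ^ i"
proof -
  have "i' = i \<and> j' = j"
    if "j' < b * 2 ^ h" "a * 2 ^ h + i * (b * 2 ^ h) + j = a * 2 ^ h + i' * (b * 2 ^ h) + j'" for i' j'
    using block_index_inject[of j "b * 2 ^ h" j' i i'] that assms by simp
  then show ?thesis unfolding tree_edge_def using assms by blast
qed

lemma tree_edge_less:
  "tree_edge a b h x y \<Longrightarrow> a * 2 ^ h \<le> y \<and> y < a * 2 ^ h + Suc h * (b * 2 ^ h)"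
  unfolding tree_edge_def using block_index_less[of _ "Suc h" _ "b * 2 ^ h"] by fastforce

lemma symp_core_adj: "symp (core_adj a b h)"
  by (auto simp: symp_def core_adj_def)

lemma irreflp_core_adj: "irreflp (core_adj a b h)"
  by (auto simp: irreflp_def core_adj_def)

lemma core_adj_leaf:
  "x < a * 2 ^ h \<Longrightarrow> a * 2 ^ h \<le> y \<Longrightarrow> core_adj a b h x y \<longleftrightarrow> tree_edge a b h x y"
  by (auto simp: core_adj_def tree_edge_def)

lemma core_adj_root:
  assumes "0 < b" "u \<noteq> a * 2 ^ h + h * (b * 2 ^ h)"
  shows "core_adj a b h (a * 2 ^ h + h * (b * 2 ^ h)) u"
proof (cases "u < a * 2 ^ h")
  case True
  then have "u div a < 2 ^ h" by (simp add: less_mult_imp_div_less mult.commute)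
  \<comment> \<open>The root vertex is position \<open>j = 0\<close> of level \<open>h\<close>;
    every leaf has ancestor 0 at that height.\<close>
  then have "tree_edge a b h u (a * 2 ^ h + h * (b * 2 ^ h) + 0)"
    using True assms(1) by (subst tree_edge_index) auto
  with assms show ?thesis by (simp add: core_adj_def)
next
  case False
  with assms show ?thesis by (simp add: core_adj_def)
qed

text \<open>After a shift by \<open>s\<close> the levels are \<open>Suc h\<close> tiles of length
  \<open>w\<close>, and a vertex determines its level and its position there.\<close>

lemma card_levels:
  fixes s w h :: nat
  shows "card {v. \<exists>i\<le>h. \<exists>j<w. v = s + i * w + j \<and> P i j} = (\<Sum>i\<le>h. card {j. j < w \<and> P i j})"
proof -
  define Z where "Z = {z. \<exists>i\<le>h. \<exists>j<w. z = i * w + j \<and> P i j}"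
  have "{v. \<exists>i\<le>h. \<exists>j<w. v = s + i * w + j \<and> P i j} = (\<lambda>z. s + z) ` Z"
    by (auto simp: Z_def image_iff add.assoc)
  then have "card {v. \<exists>i\<le>h. \<exists>j<w. v = s + i * w + j \<and> P i j} = card Z"
    by (simp add: card_image)
  also have "\<dots> = (\<Sum>i<Suc h. card {j. j < w \<and> i * w + j \<in> Z})"
  proof (rule card_tiles)
    show "Z \<subseteq> {..<Suc h * w}"
      unfolding Z_def using block_index_less[of _ "Suc h" _ w] by fastforce
  qed
  also have "\<dots> = (\<Sum>i\<le>h. card {j. j < w \<and> P i j})"
  proof (rule sum.cong)
    fix i assume "i \<in> {..h}"
    have "i * w + j \<in> Z \<longleftrightarrow> P i j" if "j < w" for j
    proof
      assume "i * w + j \<in> Z"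
      then obtain i' j' where "j' < w" "i * w + j = i' * w + j'" "P i' j'"
        by (auto simp: Z_def)
      with block_index_inject[of j w j' i i'] that show "P i j" by blast
    next
      assume "P i j"
      with that \<open>i \<in> {..h}\<close> show "i * w + j \<in> Z" by (auto simp: Z_def)
    qed
    then show "card {j. j < w \<and> i * w + j \<in> Z} = card {j. j < w \<and> P i j}"
      by (intro arg_cong[where f = card]) auto
  qed auto
  finally show ?thesis .
qed

text \<open>Fix a height \<open>i\<close> and let \<open>Q\<close> be the set of nodes above
  \<open>L\<close>. At most \<open>a * 2 ^ i\<close> points lie below each node of \<open>Q\<close>,
  while each carries \<open>b * 2 ^ i\<close> vertices, all of them neighbours of \<open>L\<close>.
  So every level contributes at least \<open>b / a\<close> times \<open>card L\<close>; multiplying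
  by \<open>a\<close> keeps the count in the naturals.\<close>

lemma tree_expansion:
  assumes "0 < a" "0 < b" and L: "L \<subseteq> {..<a * 2 ^ h}"
  shows "b * Suc h * card L \<le> a * card {v. \<exists>x\<in>L. tree_edge a b h x v}"
proof -
  have level: "b * card L \<le> a * card {j. j < b * 2 ^ h \<and> (\<exists>x\<in>L. x div a div 2 ^ i = j div b div 2 ^ i)}"
    if "i \<le> h" for i
  proof -
    define Q where "Q = (\<lambda>x. x div (a * 2 ^ i)) ` L"
    have finQ: "finite Q" unfolding Q_def using L by (intro finite_imageI) (rule finite_subset, auto)
    have pow: "2 ^ h = 2 ^ i * (2::nat) ^ (h - i)"
      using that by (simp flip: power_add)
    \<comment> \<open>Positions belonging to nodes of \<open>Q\<close> stay inside the level, so the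
      neighbours on this level form a full preimage of \<open>Q\<close> and can be counted by
      \<open>card_div_vimage\<close>.\<close>
    have "j < b * 2 ^ h" if "j div (b * 2 ^ i) = x div (a * 2 ^ i)" "x \<in> L" for j x
    proof -
      have "x < 2 ^ (h - i) * (a * 2 ^ i)" using L that pow by (auto simp: mult_ac)
      then have "j div (b * 2 ^ i) < 2 ^ (h - i)"
        unfolding that(1) by (rule less_mult_imp_div_less)
      then show ?thesis
        using assms(2) by (simp add: pow div_less_iff_less_mult mult_ac)
    qed
    then have eq: "{j. j < b * 2 ^ h \<and> (\<exists>x\<in>L. x div a div 2 ^ i = j div b div 2 ^ i)}
        = {j. j div (b * 2 ^ i) \<in> Q}"
      by (auto simp: Q_def image_iff simp flip: div_mult2_eq) metis+
    have "L \<subseteq> {x. x div (a * 2 ^ i) \<in> Q}" by (auto simp: Q_def)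
    then have "card L \<le> card {x. x div (a * 2 ^ i) \<in> Q}"
      using assms finQ by (intro card_mono finite_div_vimage) auto
    also have "\<dots> = a * 2 ^ i * card Q"
      using assms finQ by (intro card_div_vimage) auto
    finally have "b * card L \<le> b * (a * 2 ^ i * card Q)" by simp
    also have "\<dots> = a * (b * 2 ^ i * card Q)" by simp
    also have "b * 2 ^ i * card Q = card {j. j div (b * 2 ^ i) \<in> Q}"
      using assms finQ by (intro card_div_vimage[symmetric]) auto
    finally show ?thesis unfolding eq .
  qed
  have "{v. \<exists>x\<in>L. tree_edge a b h x v} = {v. \<exists>i\<le>h. \<exists>j<b * 2 ^ h. v = a * 2 ^ h + i * (b * 2 ^ h) + j
      \<and> (\<exists>x\<in>L. x div a div 2 ^ i = j div b div 2 ^ i)}"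
    using L unfolding tree_edge_def by blast
  then have "card {v. \<exists>x\<in>L. tree_edge a b h x v}
      = (\<Sum>i\<le>h. card {j. j < b * 2 ^ h \<and> (\<exists>x\<in>L. x div a div 2 ^ i = j div b div 2 ^ i)})"
    by (simp only: card_levels)
  then have "a * card {v. \<exists>x\<in>L. tree_edge a b h x v}
      = (\<Sum>i\<le>h. a * card {j. j < b * 2 ^ h \<and> (\<exists>x\<in>L. x div a div 2 ^ i = j div b div 2 ^ i)})"
    by (simp add: sum_distrib_left)
  moreover have "(\<Sum>i\<le>h. b * card L) \<le> \<dots>"
    by (intro sum_mono level) simp
  ultimately show ?thesis by (simp add: algebra_simps)
qed

text \<open>A vertex on level \<open>i\<close> has a unique neighbour in \<open>L\<close> iff its
  node lies above exactly one point of \<open>L\<close>. Each node of height \<open>i\<close>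
  carries \<open>b * 2 ^ i\<close> vertices, so the count is at most \<open>b\<close> times the
  weighted sum of \<open>weighted_unique_nodes_le\<close>.\<close>

lemma tree_unique_le:
  assumes "0 < b" and L: "L \<subseteq> {..<a * 2 ^ h}"
  shows "finite {v. card {x\<in>L. tree_edge a b h x v} = 1}"
    and "card {v. card {x\<in>L. tree_edge a b h x v} = 1} \<le> 2 * (b * 2 ^ h)"
proof -
  have finL: "finite L" using L by (rule finite_subset) simp
  define U where "U i = {q. card {x\<in>L. x div a div 2 ^ i = q} = 1}" for i
  have finU: "finite (U i)" for i
    unfolding U_def by (rule finite_subset[OF singleton_fibres_subset]) (use finL in auto)
  have eq: "{v. card {x\<in>L. tree_edge a b h x v} = 1} = {v. \<exists>i\<le>h. \<exists>j<b * 2 ^ h.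
      v = a * 2 ^ h + i * (b * 2 ^ h) + j \<and> j div b div 2 ^ i \<in> U i}"
  proof (intro set_eqI)
    fix v
    show "v \<in> {v. card {x\<in>L. tree_edge a b h x v} = 1} \<longleftrightarrow> v \<in> {v. \<exists>i\<le>h. \<exists>j<b * 2 ^ h.
      v = a * 2 ^ h + i * (b * 2 ^ h) + j \<and> j div b div 2 ^ i \<in> U i}"
    proof (cases "\<exists>i\<le>h. \<exists>j<b * 2 ^ h. v = a * 2 ^ h + i * (b * 2 ^ h) + j")
      case True
      then obtain i j where ij: "i \<le> h" "j < b * 2 ^ h" "v = a * 2 ^ h + i * (b * 2 ^ h) + j"
        by blast
      have "{x\<in>L. tree_edge a b h x v} = {x\<in>L. x div a div 2 ^ i = j div b div 2 ^ i}"
        unfolding ij(3) tree_edge_index[OF ij(1,2)] using L by auto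
      then have "card {x\<in>L. tree_edge a b h x v} = 1 \<longleftrightarrow> j div b div 2 ^ i \<in> U i"
        by (simp add: U_def)
      moreover have "i' = i \<and> j' = j"
        if "j' < b * 2 ^ h" "v = a * 2 ^ h + i' * (b * 2 ^ h) + j'" for i' j'
        using block_index_inject[of j "b * 2 ^ h" j' i i'] that ij by simp
      ultimately show ?thesis using ij by blast
    next
      case False
      then have "{x\<in>L. tree_edge a b h x v} = {}" by (auto simp: tree_edge_def)
      then have "card {x\<in>L. tree_edge a b h x v} = 0" by (simp only: card.empty)
      then have "card {x\<in>L. tree_edge a b h x v} \<noteq> 1" by linarith
      with False show ?thesis by blast
    qed
  qed
  show "finite {v. card {x\<in>L. tree_edge a b h x v} = 1}"
    unfolding eq
    by (rule finite_subset[of _ "{..<a * 2 ^ h + Suc h * (b * 2 ^ h)}"])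
      (use block_index_less[of _ "Suc h" _ "b * 2 ^ h"] in fastforce)+
  have "card {v. card {x\<in>L. tree_edge a b h x v} = 1}
      = (\<Sum>i\<le>h. card {j. j < b * 2 ^ h \<and> j div b div 2 ^ i \<in> U i})"
    unfolding eq by (rule card_levels)
  also have "\<dots> \<le> (\<Sum>i\<le>h. b * (2 ^ i * card (U i)))"
  proof (rule sum_mono)
    fix i
    have "card {j. j < b * 2 ^ h \<and> j div b div 2 ^ i \<in> U i} \<le> card {j. j div (b * 2 ^ i) \<in> U i}"
      using assms finU by (intro card_mono finite_div_vimage) (auto simp: div_mult2_eq)
    also have "\<dots> = b * 2 ^ i * card (U i)"
      using assms finU by (intro card_div_vimage) auto
    finally show "card {j. j < b * 2 ^ h \<and> j div b div 2 ^ i \<in> U i} \<le> b * (2 ^ i * card (U i))"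
      by simp
  qed
  also have "\<dots> = b * (\<Sum>i\<le>h. 2 ^ i * card (U i))"
    by (simp add: sum_distrib_left)
  also have "(\<Sum>i\<le>h. 2 ^ i * card (U i)) \<le> 2 ^ Suc h * card ((\<lambda>x. x div a div 2 ^ h) ` L)"
    unfolding U_def by (rule weighted_unique_nodes_le[OF finL])
  \<comment> \<open>At height \<open>h\<close> only the root is left, so the potential is at most
    one.\<close>
  also have "card ((\<lambda>x. x div a div 2 ^ h) ` L) \<le> card {0::nat}"
  proof (rule card_mono)
    show "(\<lambda>x. x div a div 2 ^ h) ` L \<subseteq> {0}"
      using L less_mult_imp_div_less[of _ "2 ^ h" a] by (auto simp: mult.commute)
  qed simp
  finally show "card {v. card {x\<in>L. tree_edge a b h x v} = 1} \<le> 2 * (b * 2 ^ h)"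
    by simp
qed

text \<open>If \<open>X\<close> contains a clique vertex, all of the \<open>n - a * 2 ^ h\<close>
  clique vertices outside \<open>X\<close> are its neighbours, and the size bound on
  \<open>X\<close> says that these suffice. If \<open>X\<close> lies in the independent set,
  \<open>tree_expansion\<close> applies and \<open>rate\<close> converts its factor
  \<open>b * Suc h / a\<close> into \<beta>.\<close>

lemma core_adj_expansion:
  fixes \<beta> :: real
  assumes b: "0 < b" and fits: "a * 2 ^ h + Suc h * (b * 2 ^ h) \<le> n"
    and rate: "real a * \<beta> \<le> real (b * Suc h)"
    and X: "X \<subseteq> {..<n}" "(1 + \<beta>) * real (card X) \<le> real n - real (a * 2 ^ h)"
  shows "\<beta> * real (card X) \<le> real (card {v. v < n \<and> v \<notin> X \<and> (\<exists>u\<in>X. core_adj a b h u v)})"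
    (is "_ \<le> real (card ?N)")
proof (cases "X \<subseteq> {..<a * 2 ^ h}")
  case False
  then obtain y where "y \<in> X" "y \<notin> {..<a * 2 ^ h}" by blast
  then have y: "y \<in> X" "a * 2 ^ h \<le> y" by simp_all
  have "{a * 2 ^ h..<n} - X \<subseteq> ?N"
    using y by (auto simp: core_adj_def intro!: bexI[of _ y])
  then have "card ({a * 2 ^ h..<n} - X) \<le> card ?N" by (intro card_mono) auto
  moreover have "card {a * 2 ^ h..<n} - card X \<le> card ({a * 2 ^ h..<n} - X)"
    using X by (intro diff_card_le_card_Diff) (rule finite_subset, auto)
  ultimately have "n - a * 2 ^ h \<le> card X + card ?N" by simp
  then have "real n - real (a * 2 ^ h) \<le> real (card X) + real (card ?N)"
    by (simp only: of_nat_add[symmetric] of_nat_le_iff flip: of_nat_diff)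
  with X show ?thesis by (simp add: algebra_simps)
next
  case True
  show ?thesis
  proof (cases "a = 0")
    case True
    with \<open>X \<subseteq> {..<a * 2 ^ h}\<close> show ?thesis by simp
  next
    case False
    have "{v. \<exists>x\<in>X. tree_edge a b h x v} \<subseteq> ?N"
    proof
      fix v assume "v \<in> {v. \<exists>x\<in>X. tree_edge a b h x v}"
      then obtain x where x: "x \<in> X" "tree_edge a b h x v" by blast
      from tree_edge_less[OF x(2)] fits have "a * 2 ^ h \<le> v" "v < n" by auto
      with x True show "v \<in> ?N" by (auto intro!: bexI[of _ x] simp: core_adj_def)
    qed
    then have "card {v. \<exists>x\<in>X. tree_edge a b h x v} \<le> card ?N" by (intro card_mono) auto
    then have "a * card {v. \<exists>x\<in>X. tree_edge a b h x v} \<le> a * card ?N" by simp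
    with tree_expansion[of a b X h] False b True have "b * Suc h * card X \<le> a * card ?N"
      by linarith
    then have "real (b * Suc h) * real (card X) \<le> real a * real (card ?N)"
      by (simp only: of_nat_mult[symmetric] of_nat_le_iff)
    moreover have "real a * \<beta> * real (card X) \<le> real (b * Suc h) * real (card X)"
      using rate by (rule mult_right_mono) simp
    ultimately have "real a * (\<beta> * real (card X)) \<le> real a * real (card ?N)"
      by (simp only: mult.assoc)
    with False show ?thesis by simp
  qed
qed

section \<open>Copies of the core: expansion and wireless expansion\<close>

definition core_graph :: "nat \<Rightarrow> nat \<Rightarrow> nat \<Rightarrow> nat \<Rightarrow> nat \<Rightarrow> nat pair_pre_digraph" where
  "core_graph t n a b h = copies t n (core_adj a b h)"

text \<open>Clique vertices beyond the last level pad the core to any \<open>n\<close> allowed by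
  \<open>fits\<close>. The first root vertex is adjacent to everything else in its copy, which makes
  the maximum degree exactly \<open>n - 1\<close>.\<close>

lemma core_graph_expander:
  fixes \<alpha> \<beta> :: real
  assumes "0 < t" "0 < b" and fits: "a * 2 ^ h + Suc h * (b * 2 ^ h) \<le> n"
    and "real a * \<beta> \<le> real (b * Suc h)"
    and "\<And>k::nat. real k \<le> \<alpha> * real (t * n) \<Longrightarrow> (1 + \<beta>) * real k \<le> real n - real (a * 2 ^ h)"
  shows "pair_graph (core_graph t n a b h)" "pverts (core_graph t n a b h) = {..<t * n}"
    "expander \<alpha> \<beta> (core_graph t n a b h)" "max_degree (core_graph t n a b h) = n - 1"
proof -
  show "pair_graph (core_graph t n a b h)"
    unfolding core_graph_def by (intro pair_graph_copies symp_core_adj irreflp_core_adj)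
  show "pverts (core_graph t n a b h) = {..<t * n}" by (simp add: core_graph_def)
  show "expander \<alpha> \<beta> (core_graph t n a b h)"
    unfolding core_graph_def using assms
    by (intro expander_copies core_adj_expansion) auto
  have "0 < b * 2 ^ h" using assms by simp
  with fits have "a * 2 ^ h + h * (b * 2 ^ h) < n" unfolding mult_Suc by linarith
  then show "max_degree (core_graph t n a b h) = n - 1"
    unfolding core_graph_def using assms
    by (intro max_degree_copies[where r = "a * 2 ^ h + h * (b * 2 ^ h)"] irreflp_core_adj)
      (auto intro: core_adj_root)
qed

text \<open>The witness is the independent set of copy 0 alone. Its unique neighbours stay in copy
  0, where \<open>tree_unique_le\<close> leaves at most \<open>2 * b * 2 ^ h\<close> of them against
  \<open>a * 2 ^ h\<close> vertices.\<close>

lemma core_graph_wireless_le: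
  assumes "0 < a" "0 < b" "a * 2 ^ h \<le> n" "0 < t"
    and small: "real (a * 2 ^ h) \<le> \<alpha> * real (t * n)"
  shows "wireless_expansion \<alpha> (core_graph t n a b h) \<le> 2 * real b / real a"
proof (rule wireless_expansion_le)
  let ?G = "core_graph t n a b h"
  have le: "a * 2 ^ h \<le> t * n" using assms(3,4) by (cases t) auto
  show "finite (pverts ?G)" "{..<a * 2 ^ h} \<subseteq> pverts ?G" "{..<a * 2 ^ h} \<noteq> {}"
    "real (card {..<a * 2 ^ h}) \<le> \<alpha> * real (card (pverts ?G))"
    using assms le by (auto simp: core_graph_def lessThan_empty_iff)
  fix L assume L: "L \<subseteq> {..<a * 2 ^ h}"
  have "unique_nbrs ?G {..<a * 2 ^ h} L \<subseteq> {v. card {x\<in>L. tree_edge a b h x v} = 1}"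
  proof
    fix v assume "v \<in> unique_nbrs ?G {..<a * 2 ^ h} L"
    then have v: "v < t * n" "a * 2 ^ h \<le> v" and one: "card {u\<in>L. (u, v) \<in> parcs ?G} = 1"
      by (auto simp: unique_nbrs_def core_graph_def)
    from one have "{u\<in>L. (u, v) \<in> parcs ?G} \<noteq> {}" by force
    then obtain u where "u \<in> L" "(u, v) \<in> parcs ?G" by blast
    moreover from this L assms(3) have "u < n" by auto
    ultimately have "v div n = 0" by (simp add: core_graph_def parcs_copies)
    then have "v < n" using assms by (auto simp: div_eq_0_iff)
    have "(x, v) \<in> parcs ?G \<longleftrightarrow> tree_edge a b h x v" if "x \<in> L" for x
    proof -
      have "x < a * 2 ^ h" using that L by auto
      with v \<open>v < n\<close> le assms(3) show ?thesis
        by (simp add: core_graph_def parcs_copies core_adj_leaf)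
    qed
    then have "{u\<in>L. (u, v) \<in> parcs ?G} = {x\<in>L. tree_edge a b h x v}" by blast
    with one show "v \<in> {v. card {x\<in>L. tree_edge a b h x v} = 1}" by simp
  qed
  with tree_unique_le[OF assms(2) L]
  have "card (unique_nbrs ?G {..<a * 2 ^ h} L) \<le> 2 * (b * 2 ^ h)"
    by (meson card_mono order_trans)
  then have "real (card (unique_nbrs ?G {..<a * 2 ^ h} L)) \<le> real (2 * (b * 2 ^ h))"
    by (rule of_nat_mono)
  also have "\<dots> = 2 * real b / real a * real (card {..<a * 2 ^ h})"
    using assms(1) by simp
  finally show "real (card (unique_nbrs ?G {..<a * 2 ^ h} L))
      \<le> 2 * real b / real a * real (card {..<a * 2 ^ h})" .
qed

section \<open>Existence for given \<Delta>, \<alpha> and \<beta>: number of copies and choice of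
  parameters\<close>

lemma nat_floor_bounds:
  fixes x :: real
  assumes "1 \<le> x"
  shows "0 < nat \<lfloor>x\<rfloor>" "real (nat \<lfloor>x\<rfloor>) \<le> x" "x \<le> 2 * real (nat \<lfloor>x\<rfloor>)"
proof -
  have "1 \<le> \<lfloor>x\<rfloor>" using assms by simp
  then have "real (nat \<lfloor>x\<rfloor>) = of_int \<lfloor>x\<rfloor>" "(1::real) \<le> of_int \<lfloor>x\<rfloor>" by simp_all
  then show "0 < nat \<lfloor>x\<rfloor>" "real (nat \<lfloor>x\<rfloor>) \<le> x" "x \<le> 2 * real (nat \<lfloor>x\<rfloor>)"
    using floor_correct[of x] by linarith+
qed

lemma nat_ceiling_bounds:
  fixes x :: real
  assumes "1 \<le> x"
  shows "0 < nat \<lceil>x\<rceil>" "x \<le> real (nat \<lceil>x\<rceil>)" "real (nat \<lceil>x\<rceil>) \<le> 2 * x"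
proof -
  have "1 \<le> \<lceil>x\<rceil>" using assms by linarith
  then have "real (nat \<lceil>x\<rceil>) = of_int \<lceil>x\<rceil>" "(1::real) \<le> of_int \<lceil>x\<rceil>" by simp_all
  then show "0 < nat \<lceil>x\<rceil>" "x \<le> real (nat \<lceil>x\<rceil>)" "real (nat \<lceil>x\<rceil>) \<le> 2 * x"
    using ceiling_correct[of x] assms by linarith+
qed

text \<open>Here \<open>t\<close> is the least number of copies for which a single vertex is an
  admissible set. A singleton has at most \<Delta> neighbours, which gives the bound on the wireless
  expansion.\<close>

lemma exists_complete_expander:
  fixes \<alpha> \<beta> :: real
  assumes \<beta>: "0 \<le> \<beta>" "\<beta> \<le> real \<Delta>" and \<alpha>: "0 < \<alpha>" "\<alpha> * (1 + \<beta>) \<le> 1"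
  shows "\<exists>G :: nat pair_pre_digraph. pair_graph G \<and> 1 \<le> \<alpha> * real (card (pverts G)) \<and>
    expander \<alpha> \<beta> G \<and> max_degree G = \<Delta> \<and> wireless_expansion \<alpha> G \<le> real \<Delta>"
proof -
  define n where "n = Suc \<Delta>"
  define t where "t = nat \<lceil>1 / (\<alpha> * real n)\<rceil>"
  \<comment> \<open>With \<open>a = 0\<close> the independent set is empty, so each copy is complete
    on \<open>n\<close> vertices.\<close>
  define G where "G = core_graph t n 0 1 0"
  have an: "0 < \<alpha> * real n" using \<alpha> by (simp add: n_def)
  then have t_pos: "0 < t" by (simp add: t_def)
  have "1 / (\<alpha> * real n) \<le> real t" unfolding t_def by linarith
  then have big: "1 \<le> \<alpha> * real (t * n)" using an
    by (simp only: pos_divide_le_eq) (simp add: mult_ac)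
  have main: "(1 + \<beta>) * real k \<le> real n" if k: "real k \<le> \<alpha> * real (t * n)" for k
  proof (cases "\<alpha> * real n \<le> 1")
    case True
    \<comment> \<open>By minimality of \<open>t\<close> the bound on admissible sizes is below 2,
      leaving only sets with at most one vertex; for these \<beta> \<le> \<Delta> is enough.\<close>
    have "real t < 1 / (\<alpha> * real n) + 1" using an unfolding t_def by simp linarith
    then have "real t * (\<alpha> * real n) < (1 / (\<alpha> * real n) + 1) * (\<alpha> * real n)"
      using an by (intro mult_strict_right_mono)
    also have "\<dots> = 1 + \<alpha> * real n"
      using nonzero_divide_eq_eq[THEN iffD1, OF less_imp_neq[OF an, symmetric] refl, of 1]
      by (simp only: distrib_right mult_1_left)
    finally have "real k < 2" using k True by (simp add: mult_ac)
    then have "k = 0 \<or> k = 1" by linarith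
    then show ?thesis using \<beta> by (auto simp: n_def)
  next
    case False
    then have "1 / (\<alpha> * real n) \<le> 1" by (simp add: divide_le_eq)
    moreover have "0 < 1 / (\<alpha> * real n)" using an by simp
    ultimately have "\<lceil>1 / (\<alpha> * real n)\<rceil> = 1" by linarith
    then have "real k \<le> \<alpha> * real n" using k by (simp add: t_def)
    then have "(1 + \<beta>) * real k \<le> (1 + \<beta>) * (\<alpha> * real n)"
      using \<beta> by (intro mult_left_mono) auto
    also have "\<dots> = \<alpha> * (1 + \<beta>) * real n" by simp
    also have "\<dots> \<le> 1 * real n" using \<alpha> by (intro mult_right_mono) auto
    finally show ?thesis by simp
  qed
  have fits: "0 * 2 ^ 0 + Suc 0 * (1 * 2 ^ 0) \<le> n"
    and rate: "real 0 * \<beta> \<le> real (1 * Suc 0)" by (simp_all add: n_def)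
  have "(1 + \<beta>) * real k \<le> real n - real (0 * 2 ^ 0)" if "real k \<le> \<alpha> * real (t * n)" for k
    using main[OF that] by simp
  note G = core_graph_expander[where \<alpha> = \<alpha>, OF t_pos zero_less_one fits rate this, folded G_def]
  have "wireless_expansion \<alpha> G \<le> real \<Delta>"
  proof (rule wireless_expansion_le)
    show "finite (pverts G)" "{0} \<subseteq> pverts G" "{0} \<noteq> ({} :: nat set)"
      "real (card {0::nat}) \<le> \<alpha> * real (card (pverts G))"
      using G(2) t_pos big by (auto simp: n_def)
    fix S' :: "nat set" assume S': "S' \<subseteq> {0}"
    have "unique_nbrs G {0} S' \<subseteq> {..<n} - {0}"
    proof
      fix v assume v: "v \<in> unique_nbrs G {0} S'"
      then have "card {u\<in>S'. (u, v) \<in> parcs G} = 1" by (simp add: unique_nbrs_def)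
      then have "{u\<in>S'. (u, v) \<in> parcs G} \<noteq> {}" by force
      with S' have "(0, v) \<in> parcs G" by blast
      then have "v div n = 0" by (simp add: G_def core_graph_def parcs_copies)
      with v show "v \<in> {..<n} - {0}"
        by (auto simp: div_eq_0_iff n_def unique_nbrs_def)
    qed
    then have "card (unique_nbrs G {0} S') \<le> card ({..<n} - {0})" by (intro card_mono) auto
    then show "real (card (unique_nbrs G {0} S')) \<le> real \<Delta> * real (card {0::nat})"
      by (simp add: n_def)
  qed
  with G big show ?thesis by (auto simp: n_def)
qed

text \<open>The number \<open>t\<close> of copies must satisfy two opposite demands. It must be
  small enough that admissible sets have at most \<open>(1 - d) * n / (1 + \<beta>)\<close>
  vertices, so that the clique argument works with a share \<open>d\<close> of the vertices reserved
  for the independent set. It must be large enough that the independent set is itself admissible.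
  Rounding \<open>r\<close> down costs at most a factor 2, which \<open>S_small\<close>
  absorbs.\<close>

lemma exists_core_expander:
  fixes \<alpha> \<beta> d :: real
  assumes d: "0 < d" "d \<le> 1 / 2" and "0 < \<beta>" and \<alpha>: "0 < \<alpha>" "\<alpha> * (1 + \<beta>) \<le> 1 - d"
    and ab: "0 < a" "0 < b"
    and S_small: "real (a * 2 ^ h) * (1 + \<beta>) \<le> d / 2 * real \<Delta>"
    and fits: "a * 2 ^ h + Suc h * (b * 2 ^ h) \<le> Suc \<Delta>"
    and rate: "real a * \<beta> \<le> real (b * Suc h)"
  shows "\<exists>G :: nat pair_pre_digraph. pair_graph G \<and> 1 \<le> \<alpha> * real (card (pverts G)) \<and>
    expander \<alpha> \<beta> G \<and> max_degree G = \<Delta> \<and> wireless_expansion \<alpha> G \<le> 2 * real b / real a"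
proof -
  define n where "n = Suc \<Delta>"
  define s where "s = a * 2 ^ h"
  define r where "r = (1 - d) / (\<alpha> * (1 + \<beta>))"
  define t where "t = nat \<lfloor>r\<rfloor>"
  have pos: "0 < \<alpha> * (1 + \<beta>)" using \<alpha> \<open>0 < \<beta>\<close> by simp
  then have "1 \<le> r" using \<alpha> by (simp add: r_def le_divide_eq)
  then have t: "0 < t" "real t \<le> r" "r \<le> 2 * real t"
    unfolding t_def by (fact nat_floor_bounds)+
  have r: "r * (\<alpha> * (1 + \<beta>)) = 1 - d"
    by (rule nonzero_eq_divide_eq[THEN iffD1, OF less_imp_neq[OF pos, symmetric] r_def])
  have "real t * (\<alpha> * (1 + \<beta>)) \<le> r * (\<alpha> * (1 + \<beta>))"
    using t pos by (intro mult_right_mono) auto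
  then have upper: "real t * (\<alpha> * (1 + \<beta>)) \<le> 1 - d" unfolding r .
  have "r * (\<alpha> * (1 + \<beta>)) \<le> 2 * real t * (\<alpha> * (1 + \<beta>))"
    using t pos by (intro mult_right_mono) auto
  then have lower: "(1 - d) / 2 \<le> real t * (\<alpha> * (1 + \<beta>))" unfolding r by simp
  have "d / 2 * real \<Delta> \<le> d / 2 * real n" using d by (simp add: n_def)
  with S_small have s: "real s * (1 + \<beta>) \<le> d / 2 * real n" by (simp add: s_def)
  moreover have "real s * 1 \<le> real s * (1 + \<beta>)" using \<open>0 < \<beta>\<close> by (intro mult_left_mono) auto
  moreover have "d / 2 * real n \<le> d * real n" using d by simp
  ultimately have s_le: "real s \<le> d * real n" by linarith
  have main: "(1 + \<beta>) * real k \<le> real n - real s" if k: "real k \<le> \<alpha> * real (t * n)" for k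
  proof -
    have "(1 + \<beta>) * real k \<le> (1 + \<beta>) * (\<alpha> * real (t * n))"
      using k \<open>0 < \<beta>\<close> by (intro mult_left_mono) auto
    also have "\<dots> = real t * (\<alpha> * (1 + \<beta>)) * real n" by (simp add: mult_ac)
    also have "\<dots> \<le> (1 - d) * real n" using upper by (intro mult_right_mono) auto
    finally show ?thesis using s_le by (simp add: left_diff_distrib)
  qed
  \<comment> \<open>Since \<open>d \<le> 1 / 2\<close>, the share \<open>d / 2\<close> is at most
    \<open>(1 - d) / 2\<close>, the guaranteed lower bound for
    \<open>t * \<alpha> * (1 + \<beta>)\<close>.\<close>
  have "real s * (1 + \<beta>) \<le> (1 - d) / 2 * real n"
    using s d by (intro order_trans[OF s] mult_right_mono) auto
  also have "\<dots> \<le> real t * (\<alpha> * (1 + \<beta>)) * real n" using lower by (intro mult_right_mono) auto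
  also have "\<dots> = \<alpha> * real (t * n) * (1 + \<beta>)" by (simp add: mult_ac)
  finally have small: "real s \<le> \<alpha> * real (t * n)" using \<open>0 < \<beta>\<close> by simp
  have "0 < s" using ab by (simp add: s_def)
  with small have big: "1 \<le> \<alpha> * real (t * n)" by linarith
  have "s \<le> n" using fits by (simp add: s_def n_def)
  have "wireless_expansion \<alpha> (core_graph t n a b h) \<le> 2 * real b / real a"
    using ab t small \<open>s \<le> n\<close> unfolding s_def by (intro core_graph_wireless_le) auto
  moreover note core_graph_expander[where \<alpha> = \<alpha>, OF t(1) ab(2) fits[folded n_def] rate main[unfolded s_def]]
  ultimately show ?thesis using big by (auto simp: n_def)
qed

text \<open>The height is logarithmic in \<open>M\<close>, and \<open>b / a\<close> approximates
  \<beta> / \<open>Suc h\<close> from above within a factor 2. As \<open>a\<close> and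
  \<open>b\<close> are integers, one of them is 1: for \<open>Suc h \<le> \<beta>\<close> the
  quotient is rounded up into \<open>b\<close>, otherwise its inverse is rounded down into
  \<open>a\<close>.\<close>

lemma exists_core_parameters:
  fixes \<beta> e M :: real
  assumes e: "0 < e" "e \<le> 1 / 4" and "0 < \<beta>"
    and M: "M \<le> real \<Delta> / \<beta>" "M \<le> real \<Delta> * \<beta>" "2 / e \<le> M"
  shows "\<exists>a b h. 0 < a \<and> 0 < b \<and> real (a * 2 ^ h) * (1 + \<beta>) \<le> e * real \<Delta> \<and>
    a * 2 ^ h + Suc h * (b * 2 ^ h) \<le> Suc \<Delta> \<and> real a * \<beta> \<le> real (b * Suc h) \<and>
    2 * real b / real a \<le> 4 * \<beta> / real (Suc h) \<and>
    log 2 (2 * M) \<le> (log 2 (4 / e) + 2) * real (Suc h)"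
proof -
  define x where "x = e * M / 2"
  have "1 \<le> x" using M(3) e by (simp add: x_def divide_le_eq mult_ac)
  then have "1 \<le> nat \<lfloor>x\<rfloor>" by linarith
  \<comment> \<open>The base is 4 because the tree levels have total size proportional to
    \<open>Suc h * 2 ^ h\<close>, which is at most \<open>4 ^ h\<close>. For the logarithm this only
    costs a factor 2.\<close>
  then obtain h where h: "4 ^ h \<le> nat \<lfloor>x\<rfloor>" "nat \<lfloor>x\<rfloor> < 4 ^ (h + 1)"
    using ex_power_ivl1[of 4 "nat \<lfloor>x\<rfloor>"] by auto
  have "real (4 ^ h) \<le> real (nat \<lfloor>x\<rfloor>)" using h(1) by (rule of_nat_mono)
  also have "\<dots> \<le> x" using \<open>1 \<le> x\<close> by linarith
  finally have lo: "4 ^ h \<le> x" by simp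
  have "x < real (nat \<lfloor>x\<rfloor> + 1)" using \<open>1 \<le> x\<close> by linarith
  also have "\<dots> \<le> real (4 ^ (h + 1))" using h(2) by (intro of_nat_mono) simp
  finally have hi: "x < 4 ^ Suc h" by simp
  define H where "H = real (Suc h)"
  define l :: real where "l = 2 ^ h"
  have H: "1 \<le> H" "0 < H" by (simp_all add: H_def)
  have "Suc h \<le> 2 ^ h" by (simp add: Suc_le_eq less_exp)
  then have "real (Suc h) \<le> real (2 ^ h)" by (rule of_nat_mono)
  then have "H \<le> l" by (simp add: H_def l_def)
  have "1 \<le> l" by (simp add: l_def)
  have "l * H \<le> l * l" using \<open>H \<le> l\<close> \<open>1 \<le> l\<close> by (intro mult_left_mono) auto
  also have "l * l = 4 ^ h" by (simp add: l_def flip: power_mult_distrib)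
  finally have lH: "l * H \<le> e * M / 2" using lo by (simp add: x_def)
  have "0 < M" using M(3) e by (smt (verit) divide_pos_pos)
  have "log 2 (2 * M) = log 2 (4 / e * x)" using e by (simp add: x_def)
  also have "\<dots> \<le> log 2 (4 / e * 4 ^ Suc h)"
    using e \<open>1 \<le> x\<close> hi by (intro log_mono mult_left_mono mult_pos_pos) auto
  also have "\<dots> = log 2 (4 / e) + log 2 (4 ^ Suc h)"
    using e by (intro log_mult_pos) auto
  also have "log 2 (4 ^ Suc h) = 2 * H"
  proof -
    have "(4::real) ^ Suc h = 2 ^ (2 * Suc h)" by (simp only: power_mult) simp
    then show ?thesis by (simp add: log_nat_power H_def del: power_Suc)
  qed
  also have "log 2 (4 / e) + 2 * H \<le> log 2 (4 / e) * H + 2 * H"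
  proof -
    have "0 \<le> log 2 (4 / e)" using e by (simp add: le_divide_eq)
    then have "log 2 (4 / e) * 1 \<le> log 2 (4 / e) * H" using H by (intro mult_left_mono)
    then show ?thesis by simp
  qed
  finally have log_le: "log 2 (2 * M) \<le> (log 2 (4 / e) + 2) * H"
    by (simp add: distrib_right)
  have M\<beta>: "M * \<beta> \<le> real \<Delta>" using M(1) \<open>0 < \<beta>\<close> by (simp add: le_divide_eq)
  \<comment> \<open>Both terms of the minimum enter here: together they bound
    \<open>M * (1 + \<beta>)\<close> by twice \<Delta> times the smaller of 1 and \<beta>. The bound
    with \<beta> is needed when \<open>b = 1\<close>, where \<open>a\<close> has order
    \<open>H / \<beta>\<close>.\<close>
  have "M * (1 + \<beta>) \<le> 2 * (real \<Delta> * \<beta>) \<and> M * (1 + \<beta>) \<le> 2 * real \<Delta>"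
  proof (cases "\<beta> \<le> 1")
    case True
    then have "real \<Delta> * \<beta> \<le> real \<Delta>" by (simp add: mult_left_le)
    moreover have "M * (1 + \<beta>) \<le> M * 2" using True \<open>0 < M\<close> by (intro mult_left_mono) auto
    ultimately show ?thesis using M(2) by linarith
  next
    case False
    then have "real \<Delta> * 1 \<le> real \<Delta> * \<beta>" by (intro mult_left_mono) auto
    moreover have "M * (1 + \<beta>) \<le> M * (2 * \<beta>)" using False \<open>0 < M\<close> by (intro mult_left_mono) auto
    ultimately show ?thesis using M\<beta> by linarith
  qed
  note MM = conjunct1[OF this] conjunct2[OF this]
  \<comment> \<open>The independent set and the levels together need at most
    \<open>3 * e * \<Delta>\<close> vertices, so \<open>e \<le> 1 / 4\<close> makes them
    fit.\<close>
  have "real \<Delta> * e \<le> real \<Delta> * (1 / 4)" using e by (intro mult_left_mono) auto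
  then have e\<Delta>: "e * real \<Delta> \<le> real \<Delta> / 4" by (simp add: mult.commute)
  have half_M: "e * M / 2 * (1 + \<beta>) = e / 2 * (M * (1 + \<beta>))" by simp
  have lH\<beta>: "l * H * (1 + \<beta>) \<le> e * M / 2 * (1 + \<beta>)"
    using lH \<open>0 < \<beta>\<close> by (intro mult_right_mono) auto
  also have "\<dots> \<le> e / 2 * (2 * real \<Delta>)"
    unfolding half_M using MM(2) e by (intro mult_left_mono) auto
  finally have lH\<Delta>: "l * H * (1 + \<beta>) \<le> e * real \<Delta>" by simp
  have "e * M / 2 * (1 + \<beta>) \<le> e / 2 * (2 * (real \<Delta> * \<beta>))"
    unfolding half_M using MM(1) e by (intro mult_left_mono) auto
  with lH\<beta> have lH\<Delta>\<beta>: "l * H * (1 + \<beta>) \<le> e * real \<Delta> * \<beta>" by simp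
  have l_le: "l * (1 + \<beta>) \<le> l * H * (1 + \<beta>)"
    using H \<open>1 \<le> l\<close> \<open>0 < \<beta>\<close> by (intro mult_right_mono) auto
  show ?thesis
  proof (cases "H \<le> \<beta>")
    case True
    define b where "b = nat \<lceil>\<beta> / H\<rceil>"
    have "1 \<le> \<beta> / H" using True H by simp
    then have b: "0 < b" "\<beta> / H \<le> real b" "real b \<le> 2 * (\<beta> / H)"
      unfolding b_def by (fact nat_ceiling_bounds)+
    have bH: "\<beta> \<le> real b * H" "real b * H \<le> 2 * \<beta>"
      using b H by (simp_all add: divide_le_eq le_divide_eq)
    have "l * (real b * H) \<le> l * (2 * \<beta>)" using bH \<open>1 \<le> l\<close> by (intro mult_left_mono) auto
    also have "\<dots> \<le> 2 * (l * (1 + \<beta>))" using \<open>1 \<le> l\<close> by (simp add: distrib_left)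
    finally have "l * (real b * H) \<le> 2 * (l * (1 + \<beta>))" .
    moreover have "l * 1 \<le> l * (1 + \<beta>)"
      using \<open>0 < \<beta>\<close> \<open>1 \<le> l\<close> by (intro mult_left_mono) auto
    ultimately have "l + l * (real b * H) \<le> real \<Delta>"
      using l_le lH\<Delta> e\<Delta> by linarith
    then have "real (1 * 2 ^ h + Suc h * (b * 2 ^ h)) \<le> real (Suc \<Delta>)"
      by (simp add: H_def l_def algebra_simps)
    then have "1 * 2 ^ h + Suc h * (b * 2 ^ h) \<le> Suc \<Delta>" by (simp only: of_nat_le_iff)
    moreover have "real (1 * 2 ^ h) * (1 + \<beta>) \<le> e * real \<Delta>"
      using order_trans[OF l_le lH\<Delta>] by (simp add: l_def)
    moreover have "real 1 * \<beta> \<le> real (b * Suc h)" using bH by (simp add: H_def distrib_left)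
    moreover have "2 * real b / real 1 \<le> 4 * \<beta> / real (Suc h)"
      using b unfolding H_def by simp
    ultimately show ?thesis using b(1) log_le zero_less_one unfolding H_def
      by (intro exI[of _ 1] exI[of _ b] exI[of _ h] conjI)
  next
    case False
    define a where "a = nat \<lfloor>H / \<beta>\<rfloor>"
    have "1 \<le> H / \<beta>" using False \<open>0 < \<beta>\<close> by simp
    then have a: "0 < a" "real a \<le> H / \<beta>" "H / \<beta> \<le> 2 * real a"
      unfolding a_def by (fact nat_floor_bounds)+
    have aH: "real a * \<beta> \<le> H" "H \<le> 2 * (real a * \<beta>)"
      using a \<open>0 < \<beta>\<close> by (simp_all add: divide_le_eq le_divide_eq)
    have "real a * l * (1 + \<beta>) * \<beta> = real a * \<beta> * (l * (1 + \<beta>))" by simp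
    also have "\<dots> \<le> H * (l * (1 + \<beta>))"
      using aH \<open>1 \<le> l\<close> \<open>0 < \<beta>\<close> by (intro mult_right_mono) auto
    also have "\<dots> = l * H * (1 + \<beta>)" by simp
    also note lH\<Delta>\<beta>
    finally have al: "real a * l * (1 + \<beta>) \<le> e * real \<Delta>" using \<open>0 < \<beta>\<close> by simp
    have "real a * l * 1 \<le> real a * l * (1 + \<beta>)"
      using \<open>1 \<le> l\<close> \<open>0 < \<beta>\<close> by (intro mult_left_mono) auto
    moreover have "l * H * 1 \<le> l * H * (1 + \<beta>)"
      using \<open>1 \<le> l\<close> H \<open>0 < \<beta>\<close> by (intro mult_left_mono) auto
    ultimately have "real a * l + l * H \<le> real \<Delta>" using al lH\<Delta> e\<Delta> by linarith
    then have "real (a * 2 ^ h + Suc h * (1 * 2 ^ h)) \<le> real (Suc \<Delta>)"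
      by (simp add: H_def l_def algebra_simps)
    then have "a * 2 ^ h + Suc h * (1 * 2 ^ h) \<le> Suc \<Delta>" by (simp only: of_nat_le_iff)
    moreover have "real (a * 2 ^ h) * (1 + \<beta>) \<le> e * real \<Delta>"
      using al by (simp add: l_def)
    moreover have "real a * \<beta> \<le> real (1 * Suc h)" using aH by (simp add: H_def)
    moreover have "2 * real 1 / real a \<le> 4 * \<beta> / real (Suc h)"
      using aH a(1) H unfolding H_def[symmetric] by (simp add: field_simps)
    ultimately show ?thesis using a(1) log_le zero_less_one unfolding H_def
      by (intro exI[of _ a] exI[of _ 1] exI[of _ h] conjI)
  qed
qed

text \<open>\<open>C\<close> depends on \<delta> only. The range of \<beta> makes the minimum at
  least 1, hence the logarithm at least 1, and \<open>1 \<le> \<alpha> * card (pverts G)\<close>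
  makes the wireless expansion a minimum over a nonempty family. The gap \<delta> leaves room for
  the independent set beside an admissible set and its outer neighbours.\<close>

theorem theorem1p2:
  fixes \<delta> :: real
  assumes "0 < \<delta>"
  shows "\<exists>C>0. \<forall>(\<Delta>::nat) (\<alpha>::real) (\<beta>::real).
    1 \<le> \<Delta> \<and> 1 / real \<Delta> \<le> \<beta> \<and> \<beta> \<le> real \<Delta> \<and> 0 < \<alpha> \<and> \<alpha> * (1 + \<beta>) \<le> 1 - \<delta> \<longrightarrow>
    (\<exists>G :: nat pair_pre_digraph.
       pair_graph G \<and> 1 \<le> \<alpha> * real (card (pverts G)) \<and>
       expander \<alpha> \<beta> G \<and> max_degree G = \<Delta> \<and>
       wireless_expansion \<alpha> G
         \<le> C * (\<beta> / log 2 (2 * min (real \<Delta> / \<beta>) (real \<Delta> * \<beta>))))"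
proof -
  \<comment> \<open>Capping at 1/2 gives the range required by \<open>exists_core_expander\<close>;
    \<open>e\<close> is then the share of \<Delta> available to the independent set.\<close>
  define d where "d = min \<delta> (1 / 2)"
  define e where "e = d / 2"
  define K where "K = log 2 (4 / e)"
  \<comment> \<open>The three cases below bound the wireless expansion by \<beta> times
    \<open>4 / Suc h\<close>, \<open>8 / e\<close> and \<open>8 / e ^ 3\<close>. The logarithm is at
    most \<open>(K + 2) * Suc h\<close> in the first and at most \<open>K\<close> in the others, so
    this \<open>C\<close> covers all of them.\<close>
  define C where "C = 8 / e ^ 3 * (K + 2)"
  have d: "0 < d" "d \<le> 1 / 2" "d \<le> \<delta>" using assms by (auto simp: d_def)
  then have e: "0 < e" "e \<le> 1 / 4" by (auto simp: e_def)
  have K: "0 \<le> K" using e by (simp add: K_def le_divide_eq)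
  have "e ^ 3 \<le> e" "0 < e ^ 3"
    using e power_decreasing[of 1 3 e] by auto
  then have "8 / e \<le> 8 / e ^ 3" using e by (intro divide_left_mono) auto
  moreover have "4 \<le> 8 / e" using e by (simp add: le_divide_eq)
  ultimately have e3: "4 \<le> 8 / e ^ 3" "8 / e \<le> 8 / e ^ 3" "0 < 8 / e ^ 3" by linarith+
  show ?thesis
  proof (intro exI[of _ C] conjI allI impI)
    show "0 < C" unfolding C_def using e3(3) K by (intro mult_pos_pos) auto
    fix \<Delta> :: nat and \<alpha> \<beta> :: real
    assume "1 \<le> \<Delta> \<and> 1 / real \<Delta> \<le> \<beta> \<and> \<beta> \<le> real \<Delta> \<and> 0 < \<alpha> \<and> \<alpha> * (1 + \<beta>) \<le> 1 - \<delta>"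
    then have \<Delta>: "1 \<le> \<Delta>" "1 / real \<Delta> \<le> \<beta>" "\<beta> \<le> real \<Delta>"
      and \<alpha>: "0 < \<alpha>" "\<alpha> * (1 + \<beta>) \<le> 1 - \<delta>" by auto
    then have \<alpha>d: "\<alpha> * (1 + \<beta>) \<le> 1 - d" using d by linarith
    have "0 < 1 / real \<Delta>" using \<Delta> by simp
    with \<Delta> have \<beta>: "0 < \<beta>" by linarith
    have \<Delta>\<beta>: "1 \<le> real \<Delta> * \<beta>" using \<Delta> by (simp add: divide_le_eq mult.commute)
    define M where "M = min (real \<Delta> / \<beta>) (real \<Delta> * \<beta>)"
    have M: "M \<le> real \<Delta> / \<beta>" "M \<le> real \<Delta> * \<beta>" "1 \<le> M"
      using \<Delta> \<beta> \<Delta>\<beta> by (auto simp: M_def)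
    define L where "L = log 2 (2 * M)"
    have L: "0 < L" unfolding L_def using M(3) by simp
    have suff: "w \<le> C * (\<beta> / L)" if w: "w \<le> c * \<beta>" and c: "c * L \<le> C" for w c
    proof -
      have "c \<le> C / L" using c L by (simp add: le_divide_eq)
      then have "c * \<beta> \<le> C / L * \<beta>" using \<beta> by (intro mult_right_mono) auto
      with w show ?thesis by simp
    qed
    have "\<exists>w. (\<exists>G :: nat pair_pre_digraph. pair_graph G \<and> 1 \<le> \<alpha> * real (card (pverts G)) \<and>
       expander \<alpha> \<beta> G \<and> max_degree G = \<Delta> \<and> wireless_expansion \<alpha> G \<le> w) \<and> w \<le> C * (\<beta> / L)"
    proof (cases "2 / e \<le> M")
      case True
      from exists_core_parameters[OF e \<beta> M(1,2) True]
      obtain a b h where p: "0 < a" "0 < b" "real (a * 2 ^ h) * (1 + \<beta>) \<le> e * real \<Delta>"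
        "a * 2 ^ h + Suc h * (b * 2 ^ h) \<le> Suc \<Delta>" "real a * \<beta> \<le> real (b * Suc h)"
        and w: "2 * real b / real a \<le> 4 * \<beta> / real (Suc h)"
        and log_le: "L \<le> (K + 2) * real (Suc h)"
        unfolding L_def K_def by blast
      have "4 / real (Suc h) * L \<le> 4 / real (Suc h) * ((K + 2) * real (Suc h))"
        using log_le by (intro mult_left_mono) auto
      also have "\<dots> = 4 * (K + 2)" by simp
      also have "\<dots> \<le> C" unfolding C_def using e3 K by (intro mult_right_mono) auto
      finally have "2 * real b / real a \<le> C * (\<beta> / L)"
        using w by (intro suff[of _ "4 / real (Suc h)"]) auto
      with exists_core_expander[OF d(1,2) \<beta> \<alpha>(1) \<alpha>d p(1,2) p(3)[unfolded e_def] p(4,5)]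
      show ?thesis by blast
    next
      case False
      then have "2 * M \<le> 4 / e" using e by (simp add: field_simps)
      then have LK: "L \<le> K" unfolding L_def K_def using M(3) by (intro log_mono) auto
      have C_ge: "c * L \<le> C" if "0 \<le> c" "c \<le> 8 / e ^ 3" for c
        unfolding C_def using that LK L K e3 by (intro mult_mono) auto
      show ?thesis
      proof (cases "\<beta> \<le> e / 2")
        case True
        \<comment> \<open>For small \<beta> a tree of height 0 with \<open>b = 1\<close> suffices:
          \<open>a\<close> independent vertices all joined to one clique vertex. The choice of
          \<open>a\<close> gives \<open>a * \<beta> \<le> 1\<close> and
          \<open>2 / a \<le> 8 * \<beta> / e\<close>.\<close>
        define a where "a = nat \<lfloor>e / (2 * \<beta>)\<rfloor>"
        have "1 \<le> e / (2 * \<beta>)" using True \<beta> by simp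
        then have a: "0 < a" "real a \<le> e / (2 * \<beta>)" "e / (2 * \<beta>) \<le> 2 * real a"
          unfolding a_def by (fact nat_floor_bounds)+
        then have a\<beta>: "real a * \<beta> \<le> e / 2" "e \<le> 4 * real a * \<beta>"
          using \<beta> by (simp_all add: field_simps)
        have "real a * (1 + \<beta>) \<le> e / (2 * \<beta>) * 2"
          using a True e \<beta> by (intro mult_mono) auto
        also have "\<dots> = e * (1 / \<beta>)" by simp
        also have "\<dots> \<le> e * real \<Delta>"
          using \<Delta>\<beta> e \<beta> by (intro mult_left_mono) (auto simp: divide_le_eq)
        finally have a\<Delta>: "real a * (1 + \<beta>) \<le> e * real \<Delta>" .
        have "real a * 1 \<le> real a * (1 + \<beta>)" using \<beta> by (intro mult_left_mono) auto
        moreover have "e * real \<Delta> \<le> 1 * real \<Delta>" using e by (intro mult_right_mono) auto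
        ultimately have "a \<le> \<Delta>" using a\<Delta> by linarith
        have w: "2 * real 1 / real a \<le> 8 / e * \<beta>"
          using a\<beta>(2) a(1) e by (simp add: field_simps)
        have "2 * real 1 / real a \<le> C * (\<beta> / L)"
          by (rule suff[OF w C_ge]) (use e e3 in auto)
        moreover have "real (a * 2 ^ 0) * (1 + \<beta>) \<le> d / 2 * real \<Delta>"
          "a * 2 ^ 0 + Suc 0 * (1 * 2 ^ 0) \<le> Suc \<Delta>" "real a * \<beta> \<le> real (1 * Suc 0)"
          using a\<Delta> \<open>a \<le> \<Delta>\<close> a\<beta>(1) e by (auto simp: e_def)
        note exists_core_expander[OF d(1,2) \<beta> \<alpha>(1) \<alpha>d a(1) zero_less_one this]
        ultimately show ?thesis by blast
      next
        case \<beta>_large: False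
        \<comment> \<open>With \<open>M\<close> bounded and \<beta> bounded below, the trivial bound
          \<Delta> is already of order \<beta>. If \<Delta> / \<beta> is the minimum this is
          immediate; otherwise \<open>\<Delta> * \<beta>\<close> is below \<open>2 / e\<close>, and
          comparing with \<beta> squared, at least \<open>e * e / 4\<close>, gives the
          constant.\<close>
        have w: "real \<Delta> \<le> 8 / e ^ 3 * \<beta>"
        proof (cases "real \<Delta> / \<beta> \<le> real \<Delta> * \<beta>")
          case True
          then have "real \<Delta> / \<beta> \<le> 2 / e" using False by (simp add: M_def)
          also have "\<dots> \<le> 8 / e ^ 3" using e3(2) e by (smt (verit) divide_right_mono)
          finally show ?thesis using \<beta> by (simp add: divide_le_eq)
        next
          case less: False
          then have "real \<Delta> * \<beta> \<le> 2 / e" using False by (simp add: M_def)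
          moreover have "e / 2 * (e / 2) \<le> \<beta> * \<beta>" using \<beta>_large e by (intro mult_mono) auto
          ultimately have "real \<Delta> * \<beta> * (e / 2 * (e / 2)) \<le> 2 / e * (\<beta> * \<beta>)"
            by (rule mult_mono) (use e in auto)
          then have "real \<Delta> * (e / 2 * (e / 2)) * \<beta> \<le> 2 / e * \<beta> * \<beta>" by (simp add: mult_ac)
          then have "real \<Delta> * (e / 2 * (e / 2)) \<le> 2 / e * \<beta>"
            using \<beta> by (rule mult_right_le_imp_le)
          then show ?thesis using e by (simp add: field_simps power3_eq_cube)
        qed
        have "real \<Delta> \<le> C * (\<beta> / L)"
          by (rule suff[OF w C_ge]) (use e3 in auto)
        moreover have "\<alpha> * (1 + \<beta>) \<le> 1" using \<alpha>d d by linarith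
        note exists_complete_expander[OF less_imp_le[OF \<beta>] \<Delta>(3) \<alpha>(1) this]
        ultimately show ?thesis by blast
      qed
    qed
    then show "\<exists>G :: nat pair_pre_digraph. pair_graph G \<and> 1 \<le> \<alpha> * real (card (pverts G)) \<and>
       expander \<alpha> \<beta> G \<and> max_degree G = \<Delta> \<and> wireless_expansion \<alpha> G
         \<le> C * (\<beta> / log 2 (2 * min (real \<Delta> / \<beta>) (real \<Delta> * \<beta>)))"
      unfolding M_def[symmetric] L_def[symmetric] by (blast intro: order_trans)
  qed
qed

end
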